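(* There is a positive constant $c$ such that for every $n$ and every $L>0$, at most a $2^{-L}$ fraction of the permutations $X\in S_n$ satisfy $\mathrm{OPT}(X)\le(\log_2 n!-L-n-1)/c$.
   Context: Binary search tree model: a BST on keys $[n]$ serves the access sequence $X=(x_1,\dots,x_n)$. Starting from an initial BST, each access of key $x$ is served by selecting a connected subtree containing the root and $x$, of some size $k$ (the cost of the access is $k$), and replacing it by any BST on the same keys (the remaining subtrees being reattached in the unique valid way). $\mathrm{OPT}(X)$ is the minimum total cost of serving $X$ over all initial trees and all (offline) choices of these operations. *)

theory Defs
  imports Complex_Main "HOL-Library.Tree" "HOL-Combinatorics.Multiset_Permutations"
begin

text \<open>A connected subtree containing the root is represented by the tree \<open>S\<close> obtained from \<open>T\<close>
  by cutting off everything below it; \<open>hanging S T\<close> is the set of the nonempty trees cut off.\<close>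

fun top_subtree :: "'a tree \<Rightarrow> 'a tree \<Rightarrow> bool" where
  "top_subtree Leaf T = True"
| "top_subtree (Node l a r) Leaf = False"
| "top_subtree (Node l a r) (Node l' b r') = (a = b \<and> top_subtree l l' \<and> top_subtree r r')"

fun hanging :: "'a tree \<Rightarrow> 'a tree \<Rightarrow> 'a tree set" where
  "hanging Leaf T = (if T = Leaf then {} else {T})"
| "hanging (Node l a r) Leaf = {}"
| "hanging (Node l a r) (Node l' b r') = hanging l l' \<union> hanging r r'"

text \<open>The unique valid way of reattaching the cut-off trees below \<open>S'\<close> is the one that yields a
  binary search tree \<open>T'\<close> (see \<open>reattach_ex1\<close>). Since \<open>x\<close> lies in \<open>S\<close>, \<open>S\<close> is nonempty and
  so contains the root of \<open>T\<close>.\<close>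

definition access :: "'a::linorder \<Rightarrow> nat \<Rightarrow> 'a tree \<Rightarrow> 'a tree \<Rightarrow> bool" where
  "access x k T T' \<longleftrightarrow>
     (\<exists>S S'. top_subtree S T \<and> x \<in> set_tree S \<and> size S = k \<and>
             bst S' \<and> set_tree S' = set_tree S \<and>
             bst T' \<and> top_subtree S' T' \<and> hanging S' T' = hanging S T)"

inductive serves :: "'a::linorder tree \<Rightarrow> 'a list \<Rightarrow> nat \<Rightarrow> bool" where
  "serves T [] 0"
| "access x k T T' \<Longrightarrow> serves T' X C \<Longrightarrow> serves T (x # X) (k + C)"

definition OPT :: "nat \<Rightarrow> nat list \<Rightarrow> nat" where
  "OPT n X = (LEAST C. \<exists>T. bst T \<and> set_tree T = {1..n} \<and> serves T X C)"

lemma set_hanging: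
  "top_subtree S T \<Longrightarrow> set_tree T = set_tree S \<union> (\<Union>H\<in>hanging S T. set_tree H)"
  by (induction S T rule: hanging.induct) auto

lemma hanging_nonempty: "H \<in> hanging S T \<Longrightarrow> set_tree H \<noteq> {}"
  by (induction S T rule: hanging.induct) (auto split: if_splits)

lemma reattach_unique:
  assumes "top_subtree S T" "top_subtree S T'" "bst T" "bst T'" "hanging S T = hanging S T'"
  shows "T = T'"
  using assms
proof (induction S arbitrary: T T')
  case Leaf
  then show ?case by (auto split: if_splits)
next
  case (Node l a r)
  obtain tl tr where T: "T = Node tl a tr" using Node.prems(1) by (cases T) auto
  obtain tl' tr' where T': "T' = Node tl' a tr'" using Node.prems(2) by (cases T') auto
  have l: "hanging l u = {H \<in> hanging (Node l a r) (Node u a v). \<forall>y\<in>set_tree H. y < a}"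
    and r: "hanging r v = {H \<in> hanging (Node l a r) (Node u a v). \<forall>y\<in>set_tree H. a < y}"
    if "top_subtree l u" "top_subtree r v" "bst (Node u a v)" for u v
  proof -
    have *: "\<forall>y\<in>set_tree H. y < a" if "H \<in> hanging l u" for H
      using that \<open>bst (Node u a v)\<close> set_hanging[OF \<open>top_subtree l u\<close>] by auto
    have **: "\<forall>y\<in>set_tree H. a < y" if "H \<in> hanging r v" for H
      using that \<open>bst (Node u a v)\<close> set_hanging[OF \<open>top_subtree r v\<close>] by auto
    have lr: "\<not> (\<forall>y\<in>set_tree H. y < a)" if "H \<in> hanging r v" for H
      using **[OF that] hanging_nonempty[OF that] by (meson all_not_in_conv less_asym)
    have rl: "\<not> (\<forall>y\<in>set_tree H. a < y)" if "H \<in> hanging l u" for H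
      using *[OF that] hanging_nonempty[OF that] by (meson all_not_in_conv less_asym)
    show "hanging l u = {H \<in> hanging (Node l a r) (Node u a v). \<forall>y\<in>set_tree H. y < a}"
      using * lr by auto
    show "hanging r v = {H \<in> hanging (Node l a r) (Node u a v). \<forall>y\<in>set_tree H. a < y}"
      using ** rl by auto
  qed
  have eq: "hanging (Node l a r) (Node tl a tr) = hanging (Node l a r) (Node tl' a tr')"
    using Node.prems(5) unfolding T T' .
  have t: "top_subtree l tl" "top_subtree r tr" "top_subtree l tl'" "top_subtree r tr'"
    using Node.prems(1,2) unfolding T T' by simp_all
  have b: "bst (Node tl a tr)" "bst (Node tl' a tr')"
    using Node.prems(3,4) unfolding T T' by simp_all
  have "hanging l tl = hanging l tl'"
    unfolding l[OF t(1,2) b(1)] l[OF t(3,4) b(2)] eq ..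
  then have "tl = tl'" using Node.IH(1)[OF t(1,3)] b by simp
  have "hanging r tr = hanging r tr'"
    unfolding r[OF t(1,2) b(1)] r[OF t(3,4) b(2)] eq ..
  then have "tr = tr'" using Node.IH(2)[OF t(2,4)] b by simp
  show ?case unfolding T T' \<open>tl = tl'\<close> \<open>tr = tr'\<close> ..
qed

lemma hanging_separated:
  assumes "top_subtree S T" "bst T"
  shows "\<forall>H\<in>hanging S T. bst H \<and> (\<forall>s\<in>set_tree S. (\<forall>y\<in>set_tree H. y < s) \<or> (\<forall>y\<in>set_tree H. s < y))"
    and "\<forall>H\<in>hanging S T. \<forall>K\<in>hanging S T. H \<noteq> K \<longrightarrow> (\<exists>s\<in>set_tree S.
           (\<forall>y\<in>set_tree H. y < s) \<and> (\<forall>y\<in>set_tree K. s < y) \<or>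
           (\<forall>y\<in>set_tree K. y < s) \<and> (\<forall>y\<in>set_tree H. s < y))"
proof -
  have "(\<forall>H\<in>hanging S T. bst H \<and> (\<forall>s\<in>set_tree S. (\<forall>y\<in>set_tree H. y < s) \<or> (\<forall>y\<in>set_tree H. s < y))) \<and>
    (\<forall>H\<in>hanging S T. \<forall>K\<in>hanging S T. H \<noteq> K \<longrightarrow> (\<exists>s\<in>set_tree S.
           (\<forall>y\<in>set_tree H. y < s) \<and> (\<forall>y\<in>set_tree K. s < y) \<or>
           (\<forall>y\<in>set_tree K. y < s) \<and> (\<forall>y\<in>set_tree H. s < y)))"
    using assms
  proof (induction S T rule: hanging.induct)
    case (3 l a r l' b r')
    have ab: "a = b" and tl: "top_subtree l l'" and tr: "top_subtree r r'"
      and b: "bst l'" "bst r'" and lt: "\<forall>y\<in>set_tree l'. y < a" and gt: "\<forall>y\<in>set_tree r'. a < y"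
      using "3.prems" by auto
    have kl: "\<forall>y\<in>set_tree l. y < a" and hl: "\<And>H y. H \<in> hanging l l' \<Longrightarrow> y \<in> set_tree H \<Longrightarrow> y < a"
      using set_hanging[OF tl] lt by auto
    have kr: "\<forall>y\<in>set_tree r. a < y" and hr: "\<And>H y. H \<in> hanging r r' \<Longrightarrow> y \<in> set_tree H \<Longrightarrow> a < y"
      using set_hanging[OF tr] gt by auto
    note IH1 = "3.IH"(1)[OF tl b(1)] and IH2 = "3.IH"(2)[OF tr b(2)]
    show ?case
    proof (intro conjI ballI impI)
      fix H assume "H \<in> hanging (Node l a r) (Node l' b r')"
      then show "bst H" using IH1 IH2 by auto
    next
      fix H s assume H: "H \<in> hanging (Node l a r) (Node l' b r')" and s: "s \<in> set_tree (Node l a r)"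
      from H consider "H \<in> hanging l l'" | "H \<in> hanging r r'" by auto
      then show "(\<forall>y\<in>set_tree H. y < s) \<or> (\<forall>y\<in>set_tree H. s < y)"
      proof cases
        case 1
        show ?thesis
        proof (cases "s \<in> set_tree l")
          case True then show ?thesis using IH1 1 by blast
        next
          case False
          then have "a \<le> s" using s kr by auto
          then show ?thesis using hl[OF 1] less_le_trans by blast
        qed
      next
        case 2
        show ?thesis
        proof (cases "s \<in> set_tree r")
          case True then show ?thesis using IH2 2 by blast
        next
          case False
          then have "s \<le> a" using s kl by auto
          then show ?thesis using hr[OF 2] le_less_trans by blast
        qed
      qed
    next
      fix H K assume H: "H \<in> hanging (Node l a r) (Node l' b r')"
        and K: "K \<in> hanging (Node l a r) (Node l' b r')" and "H \<noteq> K"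
      from H K consider "H \<in> hanging l l'" "K \<in> hanging l l'" | "H \<in> hanging r r'" "K \<in> hanging r r'"
        | "H \<in> hanging l l'" "K \<in> hanging r r'" | "H \<in> hanging r r'" "K \<in> hanging l l'" by auto
      then show "\<exists>s\<in>set_tree (Node l a r).
           (\<forall>y\<in>set_tree H. y < s) \<and> (\<forall>y\<in>set_tree K. s < y) \<or>
           (\<forall>y\<in>set_tree K. y < s) \<and> (\<forall>y\<in>set_tree H. s < y)"
      proof cases
        case 1 then show ?thesis using IH1 \<open>H \<noteq> K\<close> unfolding tree.set by blast
      next
        case 2 then show ?thesis using IH2 \<open>H \<noteq> K\<close> unfolding tree.set by blast
      next
        case 3 then show ?thesis using hl hr by (intro bexI[of _ a]) auto
      next
        case 4 then show ?thesis using hl hr by (intro bexI[of _ a]) auto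
      qed
    qed
  qed auto
  then show "\<forall>H\<in>hanging S T. bst H \<and> (\<forall>s\<in>set_tree S. (\<forall>y\<in>set_tree H. y < s) \<or> (\<forall>y\<in>set_tree H. s < y))"
    and "\<forall>H\<in>hanging S T. \<forall>K\<in>hanging S T. H \<noteq> K \<longrightarrow> (\<exists>s\<in>set_tree S.
           (\<forall>y\<in>set_tree H. y < s) \<and> (\<forall>y\<in>set_tree K. s < y) \<or>
           (\<forall>y\<in>set_tree K. y < s) \<and> (\<forall>y\<in>set_tree H. s < y))" by blast+
qed

lemma attach_exists:
  assumes "bst S"
    and "\<And>H. H \<in> F \<Longrightarrow> bst H \<and> set_tree H \<noteq> {} \<and>
           (\<forall>s\<in>set_tree S. (\<forall>y\<in>set_tree H. y < s) \<or> (\<forall>y\<in>set_tree H. s < y))"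
    and "\<And>H K. H \<in> F \<Longrightarrow> K \<in> F \<Longrightarrow> H \<noteq> K \<Longrightarrow> \<exists>s\<in>set_tree S.
           (\<forall>y\<in>set_tree H. y < s) \<and> (\<forall>y\<in>set_tree K. s < y) \<or>
           (\<forall>y\<in>set_tree K. y < s) \<and> (\<forall>y\<in>set_tree H. s < y)"
  shows "\<exists>T. bst T \<and> top_subtree S T \<and> hanging S T = F"
  using assms
proof (induction S arbitrary: F)
  case Leaf
  show ?case
  proof (cases "F = {}")
    case True
    then show ?thesis by (intro exI[of _ Leaf]) simp
  next
    case False
    then obtain H where H: "H \<in> F" by blast
    have F: "F = {H}" using Leaf.prems(3) H by fastforce
    have "H \<noteq> Leaf" using Leaf.prems(2)[OF H] by auto
    then show ?thesis using F Leaf.prems(2)[OF H] by (intro exI[of _ H]) simp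
  qed
next
  case (Node l a r)
  define L where "L = {H \<in> F. \<forall>y\<in>set_tree H. y < a}"
  define R where "R = {H \<in> F. \<forall>y\<in>set_tree H. a < y}"
  have F: "F = L \<union> R" using Node.prems(2) unfolding L_def R_def by fastforce
  have kl: "\<And>s. s \<in> set_tree l \<Longrightarrow> s < a" and kr: "\<And>s. s \<in> set_tree r \<Longrightarrow> a < s"
    using Node.prems(1) by auto
  have "\<exists>T. bst T \<and> top_subtree l T \<and> hanging l T = L"
  proof (rule Node.IH(1))
    show "bst l" using Node.prems(1) by simp
    show "bst H \<and> set_tree H \<noteq> {} \<and>
           (\<forall>s\<in>set_tree l. (\<forall>y\<in>set_tree H. y < s) \<or> (\<forall>y\<in>set_tree H. s < y))" if "H \<in> L" for H
      using that Node.prems(2)[of H] by (simp add: L_def)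
    fix H K assume HK: "H \<in> L" "K \<in> L" "H \<noteq> K"
    then have ne: "set_tree H \<noteq> {}" "set_tree K \<noteq> {}" using Node.prems(2) unfolding L_def by blast+
    from HK obtain s where s: "s \<in> set_tree (Node l a r)"
      "(\<forall>y\<in>set_tree H. y < s) \<and> (\<forall>y\<in>set_tree K. s < y) \<or>
       (\<forall>y\<in>set_tree K. y < s) \<and> (\<forall>y\<in>set_tree H. s < y)"
      using Node.prems(3)[of H K] unfolding L_def by blast
    have "\<exists>y\<in>set_tree H \<union> set_tree K. s < y" using s(2) ne by blast
    then have "s < a" using HK unfolding L_def by (auto dest: less_trans)
    then have "s \<in> set_tree l" using s(1) kr less_asym by auto
    then show "\<exists>s\<in>set_tree l.
           (\<forall>y\<in>set_tree H. y < s) \<and> (\<forall>y\<in>set_tree K. s < y) \<or>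
           (\<forall>y\<in>set_tree K. y < s) \<and> (\<forall>y\<in>set_tree H. s < y)" using s(2) by blast
  qed
  then obtain tl where tl: "bst tl" "top_subtree l tl" "hanging l tl = L" by blast
  have "\<exists>T. bst T \<and> top_subtree r T \<and> hanging r T = R"
  proof (rule Node.IH(2))
    show "bst r" using Node.prems(1) by simp
    show "bst H \<and> set_tree H \<noteq> {} \<and>
           (\<forall>s\<in>set_tree r. (\<forall>y\<in>set_tree H. y < s) \<or> (\<forall>y\<in>set_tree H. s < y))" if "H \<in> R" for H
      using that Node.prems(2)[of H] by (simp add: R_def)
    fix H K assume HK: "H \<in> R" "K \<in> R" "H \<noteq> K"
    then have ne: "set_tree H \<noteq> {}" "set_tree K \<noteq> {}" using Node.prems(2) unfolding R_def by blast+
    from HK obtain s where s: "s \<in> set_tree (Node l a r)"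
      "(\<forall>y\<in>set_tree H. y < s) \<and> (\<forall>y\<in>set_tree K. s < y) \<or>
       (\<forall>y\<in>set_tree K. y < s) \<and> (\<forall>y\<in>set_tree H. s < y)"
      using Node.prems(3)[of H K] unfolding R_def by blast
    have "\<exists>y\<in>set_tree H \<union> set_tree K. y < s" using s(2) ne by blast
    then have "a < s" using HK unfolding R_def by (auto dest: less_trans)
    then have "s \<in> set_tree r" using s(1) kl less_asym by auto
    then show "\<exists>s\<in>set_tree r.
           (\<forall>y\<in>set_tree H. y < s) \<and> (\<forall>y\<in>set_tree K. s < y) \<or>
           (\<forall>y\<in>set_tree K. y < s) \<and> (\<forall>y\<in>set_tree H. s < y)" using s(2) by blast
  qed
  then obtain tr where tr: "bst tr" "top_subtree r tr" "hanging r tr = R" by blast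
  have "\<forall>y\<in>set_tree tl. y < a"
    using set_hanging[OF tl(2)] tl(3) kl unfolding L_def by auto
  moreover have "\<forall>y\<in>set_tree tr. a < y"
    using set_hanging[OF tr(2)] tr(3) kr unfolding R_def by auto
  ultimately show ?case
    using tl tr F by (intro exI[of _ "Node tl a tr"]) simp
qed

lemma reattach_ex1:
  assumes "bst T" "top_subtree S T" "bst S'" "set_tree S' = set_tree S"
  shows "\<exists>!T'. bst T' \<and> top_subtree S' T' \<and> hanging S' T' = hanging S T"
proof (rule ex_ex1I)
  show "\<exists>T'. bst T' \<and> top_subtree S' T' \<and> hanging S' T' = hanging S T"
  proof (rule attach_exists[OF assms(3)])
    fix H assume H: "H \<in> hanging S T"
    show "bst H \<and> set_tree H \<noteq> {} \<and>
           (\<forall>s\<in>set_tree S'. (\<forall>y\<in>set_tree H. y < s) \<or> (\<forall>y\<in>set_tree H. s < y))"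
      using hanging_separated(1)[OF assms(2,1)] H hanging_nonempty[OF H] unfolding assms(4) by blast
    fix K assume "K \<in> hanging S T" "H \<noteq> K"
    then show "\<exists>s\<in>set_tree S'.
           (\<forall>y\<in>set_tree H. y < s) \<and> (\<forall>y\<in>set_tree K. s < y) \<or>
           (\<forall>y\<in>set_tree K. y < s) \<and> (\<forall>y\<in>set_tree H. s < y)"
      using hanging_separated(2)[OF assms(2,1)] H unfolding assms(4) by blast
  qed
qed (use reattach_unique in metis)

lemma top_subtree_refl: "top_subtree T T"
  by (induction T) auto

lemma access_refl: "bst T \<Longrightarrow> x \<in> set_tree T \<Longrightarrow> access x (size T) T T"
  unfolding access_def by (blast intro: top_subtree_refl)

lemma ex_bst: "\<exists>T. bst T \<and> set_tree T = {1..n::nat}"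
proof (induction n)
  case 0
  have "bst (Leaf :: nat tree) \<and> set_tree (Leaf :: nat tree) = {1..0}" by simp
  then show ?case by blast
next
  case (Suc n)
  then obtain T where "bst T" "set_tree T = {1..n}" by blast
  then have "bst (Node T (Suc n) Leaf) \<and> set_tree (Node T (Suc n) Leaf) = {1..Suc n}" by auto
  then show ?case by blast
qed

text \<open>The minimum in \<open>OPT\<close> is over a nonempty set.\<close>

lemma OPT_attained:
  assumes "set X \<subseteq> {1..n}"
  shows "\<exists>T. bst T \<and> set_tree T = {1..n} \<and> serves T X (OPT n X)"
proof -
  obtain T :: "nat tree" where T: "bst T" "set_tree T = {1..n}" using ex_bst by blast
  have "\<exists>C. serves T X C" using assms
  proof (induction X)
    case Nil
    show ?case using serves.intros(1) by blast
  next
    case (Cons x X)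
    then obtain C where "serves T X C" by auto
    moreover have "access x (size T) T T" using Cons.prems T by (intro access_refl) auto
    ultimately show ?case using serves.intros(2) by blast
  qed
  with T have "\<exists>C T. bst T \<and> set_tree T = {1..n} \<and> serves T X C" by blast
  then show ?thesis unfolding OPT_def by (rule LeastI_ex)
qed

end

theory Submission
  imports Defs
begin

text \<open>A counting argument. An access of cost \<open>k\<close> is determined by the shapes of the replaced
  and of the replacing subtree (at most \<open>4 ^ k\<close> choices each) and by which of its \<open>k\<close> keys is
  accessed, so from a given tree there are at most \<open>32 ^ k\<close> accesses of cost \<open>k\<close>. As every access
  costs at least 1, at most \<open>64 ^ C\<close> sequences are served at cost exactly \<open>C\<close> from a given tree.
  There are at most \<open>4 ^ n\<close> initial trees, and the factor \<open>2 ^ n\<close> of it that the bound does not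
  provide for is absorbed by the constant because serving a permutation costs at least \<open>n\<close>.\<close>

section \<open>Counting trees and top subtrees by shape\<close>

text \<open>The balanced-parenthesis word of a binary tree, with \<open>True\<close> as opening and
  \<open>False\<close> as closing parenthesis.\<close>

fun shape_code :: "unit tree \<Rightarrow> bool list" where
  "shape_code Leaf = []"
| "shape_code (Node l a r) = True # shape_code l @ False # shape_code r"

abbreviation shape :: "'a tree \<Rightarrow> unit tree" where
  "shape \<equiv> map_tree (\<lambda>_. ())"

text \<open>Unique parsing. A code does not mark its own end: a \<open>True\<close> after it could
  be read as one more node on the right spine, so the continuations must not start with
  \<open>True\<close>; \<open>take 1\<close> also covers empty ones. In the induction the left code
  is followed by \<open>False\<close>, the right one by the given rest.\<close>

lemma shape_code_append_eq:
  assumes "shape_code s @ xs = shape_code t @ ys" "True \<notin> set (take 1 xs)" "True \<notin> set (take 1 ys)"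
  shows "s = t \<and> xs = ys"
  using assms
proof (induction s arbitrary: t xs ys)
  case Leaf
  then show ?case by (cases t) auto
next
  case (Node l a r)
  show ?case
  proof (cases t)
    case Leaf
    then show ?thesis using Node.prems by auto
  next
    case (Node l' b r')
    have "shape_code l @ False # shape_code r @ xs = shape_code l' @ False # shape_code r' @ ys"
      using Node.prems(1) Node by simp
    then have "l = l' \<and> False # shape_code r @ xs = False # shape_code r' @ ys"
      by (rule Node.IH(1)) auto
    moreover from this have "r = r' \<and> xs = ys"
      using Node.IH(2)[of xs r' ys] Node.prems by simp
    ultimately show ?thesis using Node by simp
  qed
qed

lemma inj_shape_code: "inj shape_code"
  using shape_code_append_eq[of _ "[]" _ "[]"] by (auto intro: injI)

lemma length_shape_code: "length (shape_code t) = 2 * size t"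
  by (induction t) auto

lemma finite_card_shapes:
  "finite {t :: unit tree. size t = k}" (is "finite ?A")
  "card {t :: unit tree. size t = k} \<le> 4 ^ k"
proof -
  let ?B = "{xs :: bool list. set xs \<subseteq> UNIV \<and> length xs = 2 * k}"
  have sub: "shape_code ` ?A \<subseteq> ?B" by (auto simp: length_shape_code)
  have fin: "finite ?B" by (rule finite_lists_length_eq) simp
  have inj: "inj_on shape_code ?A" using inj_shape_code inj_on_subset by blast
  show "finite ?A" using finite_imageD[OF finite_subset[OF sub fin] inj] .
  have "card ?A \<le> card ?B" by (rule card_inj_on_le[OF inj sub fin])
  also have "\<dots> = 4 ^ k"
    by (subst card_lists_length_eq) (auto simp: power_mult)
  finally show "card ?A \<le> 4 ^ k" .
qed

text \<open>Serves both counts below: BSTs on a fixed key set and top subtrees of a fixed tree are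
  each determined by their shape.\<close>

lemma finite_card_inj_shape:
  assumes "inj_on shape A" "\<And>t. t \<in> A \<Longrightarrow> size t = k"
  shows "finite A" "card A \<le> 4 ^ k"
proof -
  have sub: "shape ` A \<subseteq> {t. size t = k}" using assms(2) by auto
  show "finite A"
    using finite_imageD[OF finite_subset[OF sub finite_card_shapes(1)] assms(1)] .
  show "card A \<le> 4 ^ k"
    using card_inj_on_le[OF assms(1) sub finite_card_shapes(1)] finite_card_shapes(2) le_trans
    by blast
qed

text \<open>The shape fixes the size of the left subtree, hence the place where the inorder list
  splits.\<close>

lemma inorder_shape_eq: "inorder s = inorder t \<Longrightarrow> shape s = shape t \<Longrightarrow> s = t"
proof (induction s arbitrary: t)
  case Leaf
  then show ?case by (cases t) auto
next
  case (Node l a r)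
  then obtain l' b r' where t: "t = Node l' b r'" by (cases t) auto
  then have "shape l = shape l'" using Node.prems by simp
  then have "size l = size l'" by (metis size_map_tree)
  then have "length (inorder l) = length (inorder l')" by simp
  then show ?case using Node t by simp
qed

lemma size_bst: "bst t \<Longrightarrow> size t = card (set_tree t)"
  using distinct_card[of "inorder t"] by (simp add: bst_iff_sorted_wrt_less strict_sorted_iff)

text \<open>All BSTs on \<open>A\<close> have the same inorder list, the increasing one, so only the
  shape is free.\<close>

lemma finite_card_bsts:
  fixes A :: "'a::linorder set"
  shows "finite {t. bst t \<and> set_tree t = A}" "card {t. bst t \<and> set_tree t = A} \<le> 4 ^ card A"
proof -
  have inj: "inj_on shape {t. bst t \<and> set_tree t = A}"
  proof (rule inj_onI)
    fix s t assume "s \<in> {t. bst t \<and> set_tree t = A}" "t \<in> {t. bst t \<and> set_tree t = A}"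
      and shape: "shape s = shape t"
    then have "inorder s = inorder t"
      by (intro strict_sorted_equal) (auto simp: bst_iff_sorted_wrt_less)
    then show "s = t" using shape by (rule inorder_shape_eq)
  qed
  have size: "size t = card A" if "t \<in> {t. bst t \<and> set_tree t = A}" for t
    using that size_bst by blast
  show "finite {t. bst t \<and> set_tree t = A}" "card {t. bst t \<and> set_tree t = A} \<le> 4 ^ card A"
    by (rule finite_card_inj_shape[OF inj size]; assumption)+
qed

text \<open>The keys at the positions given by the shape are read off from \<open>T\<close>.\<close>

lemma top_subtree_shape_eq:
  "top_subtree S T \<Longrightarrow> top_subtree S' T \<Longrightarrow> shape S = shape S' \<Longrightarrow> S = S'"
proof (induction S T arbitrary: S' rule: top_subtree.induct)
  case (1 T)
  then show ?case by (cases S') auto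
next
  case (3 l a r l' b r')
  then show ?case by (cases S') auto
qed auto

lemma finite_card_top_subtrees:
  "finite {S. top_subtree S T \<and> size S = k}" "card {S. top_subtree S T \<and> size S = k} \<le> 4 ^ k"
proof -
  have inj: "inj_on shape {S. top_subtree S T \<and> size S = k}"
    using top_subtree_shape_eq unfolding inj_on_def by blast
  show "finite {S. top_subtree S T \<and> size S = k}"
    "card {S. top_subtree S T \<and> size S = k} \<le> 4 ^ k"
    by (rule finite_card_inj_shape[OF inj]; simp)+
qed

section \<open>Accesses from a fixed tree\<close>

lemma bst_top_subtree: "top_subtree S T \<Longrightarrow> bst T \<Longrightarrow> bst S"
proof (induction S T rule: top_subtree.induct)
  case (3 l a r l' b r')
  then have "set_tree l \<subseteq> set_tree l'" "set_tree r \<subseteq> set_tree r'"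
    using set_hanging[of l l'] set_hanging[of r r'] by auto
  then show ?case using 3 by auto
qed simp_all

lemma card_UN_le_mult:
  assumes "finite I" "\<And>i. i \<in> I \<Longrightarrow> card (A i) \<le> b"
  shows "card (\<Union>i\<in>I. A i) \<le> card I * b"
proof -
  have "card (\<Union>i\<in>I. A i) \<le> (\<Sum>i\<in>I. card (A i))" by (rule card_UN_le[OF assms(1)])
  also have "\<dots> \<le> card I * b" using sum_bounded_above[of I "\<lambda>i. card (A i)" b] assms(2) by simp
  finally show ?thesis .
qed

lemma finite_card_accesses:
  assumes "bst T"
  shows "finite {(x, T'). access x k T T'}" "card {(x, T'). access x k T T'} \<le> 32 ^ k"
proof -
  define Top where "Top = {S. top_subtree S T \<and> size S = k}"
  define New where "New S = {S'. bst S' \<and> set_tree S' = set_tree S}" for S :: "'a tree"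
  define Res where "Res S S' = {T'. bst T' \<and> top_subtree S' T' \<and> hanging S' T' = hanging S T}"
    for S S' :: "'a tree"
  define U where "U = (\<Union>S\<in>Top. \<Union>S'\<in>New S. set_tree S \<times> Res S S')"
  have sub: "{(x, T'). access x k T T'} \<subseteq> U"
    unfolding access_def U_def Top_def New_def Res_def by blast
  have k: "card (set_tree S) = k" if "S \<in> Top" for S
    using that size_bst[OF bst_top_subtree[OF _ assms]] unfolding Top_def by auto
  \<comment> \<open>Reattachment is unique, so \<open>S\<close> and \<open>S'\<close> leave at most
    one resulting tree.\<close>
  have Res: "finite (Res S S') \<and> card (Res S S') \<le> 1" for S S'
  proof (cases "Res S S' = {}")
    case False
    then obtain T' where "T' \<in> Res S S'" by blast
    then have "Res S S' \<subseteq> {T'}" unfolding Res_def using reattach_unique by blast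
    then show ?thesis using card_mono[of "{T'}" "Res S S'"] finite_subset[of _ "{T'}"] by simp
  qed simp
  have fin: "finite U"
    unfolding U_def Top_def New_def
    by (intro finite_UN_I finite_card_top_subtrees finite_card_bsts finite_cartesian_product)
      (auto simp: Res)
  then show "finite {(x, T'). access x k T T'}" using sub finite_subset by blast
  have "card (\<Union>S'\<in>New S. set_tree S \<times> Res S S') \<le> 4 ^ k * k" if S: "S \<in> Top" for S
  proof -
    have "card (\<Union>S'\<in>New S. set_tree S \<times> Res S S') \<le> card (New S) * k"
      unfolding New_def
      by (rule card_UN_le_mult[OF finite_card_bsts(1)])
        (use Res k[OF S] in \<open>simp add: card_cartesian_product\<close>)
    also have "\<dots> \<le> 4 ^ k * k"
      using finite_card_bsts(2)[of "set_tree S"] k[OF S] unfolding New_def by simp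
    finally show ?thesis .
  qed
  then have "card U \<le> card Top * (4 ^ k * k)"
    unfolding U_def by (intro card_UN_le_mult) (simp_all add: Top_def finite_card_top_subtrees)
  \<comment> \<open>The \<open>k\<close> choices of the accessed key are bounded by
    \<open>2 ^ k\<close> to get a pure exponential.\<close>
  also have "\<dots> \<le> 4 ^ k * (4 ^ k * 2 ^ k)"
    using finite_card_top_subtrees(2)[of T k] unfolding Top_def
    by (intro mult_le_mono) (auto simp: less_imp_le)
  also have "\<dots> = 32 ^ k" by (simp flip: power_mult_distrib)
  finally have "card U \<le> 32 ^ k" .
  then show "card {(x, T'). access x k T T'} \<le> 32 ^ k"
    using card_mono[OF fin sub] by linarith
qed

section \<open>Sequences served at a given cost\<close>

lemma access_cost_pos: "access x k T T' \<Longrightarrow> k > 0"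
  unfolding access_def by (cases k) auto

lemma length_le_cost: "serves T X C \<Longrightarrow> length X \<le> C"
  by (induction rule: serves.induct) (auto dest: access_cost_pos)

text \<open>The base 64 is twice 32, so the \<open>k\<close>-th term is \<open>64 ^ C\<close>
  divided by \<open>2 ^ k\<close>, and these fractions sum to less than 1. This lets the bound
  \<open>64 ^ C\<close> reproduce itself in the recursion on the first access.\<close>

lemma sum_geometric_32_64: "(\<Sum>k=1..C. 32 ^ k * 64 ^ (C - k)) + 32 ^ C = (64 :: nat) ^ C"
proof (induction C)
  case (Suc C)
  have "(\<Sum>k=1..C. 32 ^ k * 64 ^ (Suc C - k)) = 64 * (\<Sum>k=1..C. 32 ^ k * (64 :: nat) ^ (C - k))"
    unfolding sum_distrib_left by (rule sum.cong) (auto simp: Suc_diff_le)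
  then show ?case using Suc by simp
qed simp

text \<open>Strong induction on the cost, for all trees at once: the first access changes the tree
  and uses up a positive cost. Finiteness is carried along since \<open>card\<close> is 0 on
  infinite sets.\<close>

lemma finite_card_served:
  "bst T \<Longrightarrow> finite {X. serves T X C} \<and> card {X. serves T X C} \<le> 64 ^ C"
proof (induction C arbitrary: T rule: less_induct)
  case (less C)
  show ?case
  proof (cases "C = 0")
    case True
    then have sub: "{X. serves T X C} \<subseteq> {[]}" using length_le_cost[of T _ 0] by auto
    show ?thesis using True card_mono[OF _ sub] finite_subset[OF sub] by simp
  next
    case False
    define P where "P k = {(x, T'). access x k T T'}" for k
    define Q where "Q k = (\<Union>(x, T')\<in>P k. (#) x ` {X. serves T' X (C - k)})" for k
    have Q: "finite (Q k) \<and> card (Q k) \<le> 32 ^ k * 64 ^ (C - k)" if k: "k \<in> {1..C}" for k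
    proof
      have IH: "finite {X. serves T' X (C - k)} \<and> card {X. serves T' X (C - k)} \<le> 64 ^ (C - k)"
        if "(x, T') \<in> P k" for x T'
        by (rule less.IH) (use k that in \<open>auto simp: P_def access_def\<close>)
      have fin: "finite (P k)"
        unfolding P_def by (rule finite_card_accesses[OF less.prems])
      show "finite (Q k)"
        unfolding Q_def by (rule finite_UN_I[OF fin]) (use IH in auto)
      have "card (Q k) \<le> card (P k) * 64 ^ (C - k)"
        unfolding Q_def using fin
        by (rule card_UN_le_mult) (use IH in \<open>auto simp: card_image\<close>)
      also have "\<dots> \<le> 32 ^ k * 64 ^ (C - k)"
        unfolding P_def by (intro mult_le_mono finite_card_accesses[OF less.prems]) simp
      finally show "card (Q k) \<le> 32 ^ k * 64 ^ (C - k)" .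
    qed
    have sub: "{X. serves T X C} \<subseteq> (\<Union>k\<in>{1..C}. Q k)"
    proof
      fix X assume "X \<in> {X. serves T X C}"
      then have "serves T X C" by simp
      then show "X \<in> (\<Union>k\<in>{1..C}. Q k)"
      proof cases
        case 1
        then show ?thesis using False by simp
      next
        case (2 x k T' X' C')
        then have "k \<in> {1..C}" "X \<in> Q k"
          using access_cost_pos[OF 2(3)] by (auto simp: Q_def P_def)
        then show ?thesis by blast
      qed
    qed
    have fin: "finite (\<Union>k\<in>{1..C}. Q k)" using Q by (intro finite_UN_I) simp_all
    have "card {X. serves T X C} \<le> card (\<Union>k\<in>{1..C}. Q k)" by (rule card_mono[OF fin sub])
    also have "\<dots> \<le> (\<Sum>k=1..C. card (Q k))" by (rule card_UN_le) simp
    also have "\<dots> \<le> (\<Sum>k=1..C. 32 ^ k * 64 ^ (C - k))" using Q by (intro sum_mono) blast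
    also have "\<dots> \<le> 64 ^ C" using sum_geometric_32_64[of C] by linarith
    finally show ?thesis using finite_subset[OF sub fin] by blast
  qed
qed

section \<open>Permutations of small optimal cost\<close>

lemma card_OPT_le:
  "card {X \<in> permutations_of_set {1..n}. OPT n X \<le> C} \<le> 4 ^ n * (2 * 64 ^ C)"
proof -
  define I where "I = {T. bst T \<and> set_tree T = {1..n}}"
  have served: "finite {X. serves T X C'} \<and> card {X. serves T X C'} \<le> 64 ^ C'"
    if "T \<in> I" for T C'
    using finite_card_served[of T C'] that by (simp add: I_def)
  have finI: "finite I" unfolding I_def by (rule finite_card_bsts)
  \<comment> \<open>Passing from exact cost to cost at most \<open>C\<close> loses only a factor
    2.\<close>
  have geometric: "(\<Sum>C'\<le>C. 64 ^ C') \<le> 2 * (64 :: nat) ^ C"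
    by (induction C) auto
  have "{X \<in> permutations_of_set {1..n}. OPT n X \<le> C}
      \<subseteq> (\<Union>T\<in>I. \<Union>C'\<in>{..C}. {X. serves T X C'})"
  proof
    fix X assume "X \<in> {X \<in> permutations_of_set {1..n}. OPT n X \<le> C}"
    then have "set X \<subseteq> {1..n}" "OPT n X \<le> C" by (auto simp: permutations_of_set_def)
    then show "X \<in> (\<Union>T\<in>I. \<Union>C'\<in>{..C}. {X. serves T X C'})"
      using OPT_attained[of X n] unfolding I_def by blast
  qed
  moreover have "finite (\<Union>T\<in>I. \<Union>C'\<in>{..C}. {X. serves T X C'})"
    using finI served by (intro finite_UN_I) simp_all
  ultimately have "card {X \<in> permutations_of_set {1..n}. OPT n X \<le> C}
      \<le> card (\<Union>T\<in>I. \<Union>C'\<in>{..C}. {X. serves T X C'})"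
    by (intro card_mono)
  also have "\<dots> \<le> card I * (2 * 64 ^ C)"
  proof (rule card_UN_le_mult[OF finI])
    fix T assume T: "T \<in> I"
    have "card (\<Union>C'\<in>{..C}. {X. serves T X C'}) \<le> (\<Sum>C'\<le>C. card {X. serves T X C'})"
      by (rule card_UN_le) simp
    also have "\<dots> \<le> (\<Sum>C'\<le>C. 64 ^ C')" using served[OF T] by (intro sum_mono) blast
    finally show "card (\<Union>C'\<in>{..C}. {X. serves T X C'}) \<le> 2 * 64 ^ C"
      using geometric by linarith
  qed
  also have "\<dots> \<le> 4 ^ n * (2 * 64 ^ C)"
    using finite_card_bsts(2)[of "{1..n}"] unfolding I_def by simp
  finally show ?thesis .
qed

lemma le_OPT: "X \<in> permutations_of_set {1..n} \<Longrightarrow> n \<le> OPT n X"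
  by (metis OPT_attained card_atLeastAtMost diff_Suc_1 length_finite_permutations_of_set
    length_le_cost order_refl permutations_of_setD(1))

theorem mainTheorem17:
  "\<exists>c::real. c > 0 \<and>
     (\<forall>(n::nat) (L::real). L > 0 \<longrightarrow>
        real (card {X \<in> permutations_of_set {1..n}.
                      real (OPT n X) \<le> (log 2 (fact n) - L - real n - 1) / c})
          / real (card (permutations_of_set {1..n}))
        \<le> 2 powr (- L))"
\<comment> \<open>Here 7 = 6 + 1: each unit of cost contributes 6 bits, as 64 is
  \<open>2 ^ 6\<close>, and one further \<open>B\<close> pays for the surplus \<open>n\<close> bits
  of the initial tree.\<close>
proof (intro exI[of _ 7] conjI allI impI)
  fix n :: nat and L :: real
  define B where "B = (log 2 (fact n) - L - real n - 1) / 7"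
  define G where "G = {X \<in> permutations_of_set {1..n}. real (OPT n X) \<le> B}"
  have "real (card G) \<le> 2 powr (- L) * fact n"
  \<comment> \<open>Only a member of \<open>G\<close> yields \<open>n \<le> B\<close>; without one
    the bound is trivial.\<close>
  proof (cases "G = {}")
    case False
    then obtain X where X: "X \<in> permutations_of_set {1..n}" "real (OPT n X) \<le> B"
      by (auto simp: G_def)
    then have nB: "real n \<le> B" using le_OPT[OF X(1)] by linarith
    \<comment> \<open>Since \<open>B\<close> is nonnegative here, \<open>nat\<close> leaves the
      floor unchanged.\<close>
    define C where "C = nat \<lfloor>B\<rfloor>"
    have C: "real C \<le> B" using nB by (simp add: C_def)
    have "G = {X \<in> permutations_of_set {1..n}. OPT n X \<le> C}"
      using nB by (auto simp: G_def C_def le_nat_iff le_floor_iff)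
    then have "real (card G) \<le> real (4 ^ n * (2 * 64 ^ C))"
      using card_OPT_le[of n C] by (simp only: of_nat_le_iff)
    also have "\<dots> = 2 ^ (2 * n + 1 + 6 * C)"
      by (simp add: power_add power_mult)
    also have "\<dots> = 2 powr (2 * real n + 1 + 6 * real C)"
      by (subst powr_realpow[symmetric]) (simp_all add: ac_simps)
    \<comment> \<open>The exponent on the right equals \<open>7 * B + n + 1\<close>, so
      \<open>C \<le> B\<close> and \<open>n \<le> B\<close> suffice.\<close>
    also have "\<dots> \<le> 2 powr (log 2 (fact n) - L)"
      using nB C by (intro powr_mono) (auto simp: B_def)
    also have "\<dots> = 2 powr (- L) * fact n"
      by (simp add: powr_diff powr_minus field_simps)
    finally show ?thesis .
  qed simp
  then show "real (card {X \<in> permutations_of_set {1..n}.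
                real (OPT n X) \<le> (log 2 (fact n) - L - real n - 1) / 7})
          / real (card (permutations_of_set {1..n})) \<le> 2 powr (- L)"
    by (simp add: G_def B_def divide_le_eq)
qed simp

end
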